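(* For every word $\omega\in[n]^*$, $B_\omega=\mathrm{Comp}_0(X_\omega)$, where \[X_\omega=\bigcap_{i=1}^n\{x\in\mathbb{Z}^n: 0\le e_i^T M_\omega x\le e_i^T u_\omega\}.\]
   Context: Let $[n]=\{1,\dots,n\}$, $e_1,\dots,e_n$ the standard basis of $\mathbb{Z}^n$; $\varepsilon$ is the empty word, $*$ concatenation. For words $\omega$ over $[n]$ define recursively $\delta^i_\omega\in\mathbb{Z}^n$: $\delta^i_\varepsilon=e_i$; $\delta^j_{\omega*j}=\delta^j_\omega$, $\delta^i_{\omega*j}=\delta^i_\omega-\delta^j_\omega$ for $i\ne j$. Let $B_\varepsilon=\{0\}$, $B_{\omega*j}=B_\omega+\{0,\delta^j_\omega\}$ (Minkowski sum). Let $M_\omega=(\delta^1_\omega\ \cdots\ \delta^n_\omega)^{-1}$ (inverse of the matrix with columns $\delta^i_\omega$). For $k\in[n]$ let $D^k=\mathrm{id}+e_k(\mathbb{1}-e_k)^T$ with $\mathbb{1}=(1,\dots,1)^T$. Define $u_\varepsilon=0$, $u_{\omega*j}=e_j+D^j u_\omega$. A subset of $\mathbb{Z}^n$ is regarded as a graph by joining two elements iff their Euclidean distance is $1$; for $X\subseteq\mathbb{Z}^n$, $\mathrm{Comp}_0(X)$ denotes the connected component of $X$ containing $0$. *)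

theory Defs
  imports "HOL-Analysis.Analysis"
begin

text \<open>The index set [n] is a finite type 'n (n = CARD('n)); words over [n] are lists
  of elements of 'n, with the last letter of a word being the last list element.
  Vectors in Z^n are int^'n.  The recursive definitions (which peel off the LAST
  letter of a word) are given on the reversed word.\<close>

definition unitv :: "'n::finite \<Rightarrow> int ^ 'n" where
  "unitv i = axis i 1"

primrec deltaR :: "'n::finite list \<Rightarrow> 'n \<Rightarrow> int ^ 'n" where
  "deltaR [] i = unitv i"
| "deltaR (j # r) i = (if i = j then deltaR r j else deltaR r i - deltaR r j)"

definition delta :: "'n::finite list \<Rightarrow> 'n \<Rightarrow> int ^ 'n" where
  "delta w i = deltaR (rev w) i"

primrec BR :: "'n::finite list \<Rightarrow> (int ^ 'n) set" where
  "BR [] = {0}"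
| "BR (j # r) = {a + b | a b. a \<in> BR r \<and> b \<in> {0, deltaR r j}}"

definition Bw :: "'n::finite list \<Rightarrow> (int ^ 'n) set" where
  "Bw w = BR (rev w)"

definition Mw :: "'n::finite list \<Rightarrow> real ^ 'n ^ 'n" where
  "Mw w = matrix_inv (\<chi> a b. real_of_int (delta w b $ a))"

definition Dmat :: "'n::finite \<Rightarrow> int ^ 'n ^ 'n" where
  "Dmat k = mat 1 + (\<chi> a b. unitv k $ a * (vec 1 - unitv k) $ b)"

primrec uR :: "'n::finite list \<Rightarrow> int ^ 'n" where
  "uR [] = 0"
| "uR (j # r) = unitv j + Dmat j *v uR r"

definition uw :: "'n::finite list \<Rightarrow> int ^ 'n" where
  "uw w = uR (rev w)"

definition to_real :: "int ^ 'n::finite \<Rightarrow> real ^ 'n" where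
  "to_real x = (\<chi> k. real_of_int (x $ k))"

definition Xw :: "'n::finite list \<Rightarrow> (int ^ 'n) set" where
  "Xw w = {x. \<forall>i. 0 \<le> (Mw w *v to_real x) $ i \<and> (Mw w *v to_real x) $ i \<le> real_of_int (uw w $ i)}"

text \<open>Lattice graph: two points are adjacent iff their Euclidean distance is 1.\<close>
definition adjacent :: "int ^ 'n::finite \<Rightarrow> int ^ 'n \<Rightarrow> bool" where
  "adjacent x y \<longleftrightarrow> dist (to_real x) (to_real y) = 1"

text \<open>Connected component of 0 in the induced subgraph on X (empty if 0 \<notin> X).\<close>
definition Comp0 :: "(int ^ 'n::finite) set \<Rightarrow> (int ^ 'n) set" where
  "Comp0 X = {y. 0 \<in> X \<and> (\<lambda>a b. a \<in> X \<and> b \<in> X \<and> adjacent a b)\<^sup>*\<^sup>* 0 y}"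

end

theory Submission
  imports Defs
begin

(* Everything is done for the reversed word r = rev w, so that the last letter of w is the
   head of r.  With the integer matrix M = MR r (which is M_w) the substitution x = Delta p,
   Delta = M^-1, turns X_w into the lattice box 0 <= p <= u_w.  The set B_w corresponds to
   the Parikh vectors of the prefixes of a word path_word r of Parikh vector u_w, obtained
   by iterating the Arnoux-Rauzy-type substitutions  j -> j, i -> i j.  A unit step +-e_k in
   x becomes the step +-M e_k in p, and M e_k is the Parikh vector of a word step_word r k
   of which path_word r is a suffix of a power.  So a neighbour of a prefix point stays in
   the box only if it is the prefix point |step_word r k| letters further or earlier (the
   coordinate sum of p counts letters), i.e. B_w is closed in X_w; and the prefix lengths
   0..|path_word r| are connected by jumps of the lengths |step_word r k|, by a Euclid-like
   induction on r. *)

lemma unitv_nth: "unitv a $ i = (if i = a then 1 else 0)"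
  by (simp add: unitv_def axis_def)

lemma matrix_vector_mult_unitv: "A *v unitv b = (\<chi> a. A $ a $ b)"
proof -
  have "(\<Sum>c\<in>UNIV. A $ a $ c * unitv b $ c) = A $ a $ b" for a
    by (simp add: unitv_nth if_distrib cong: if_cong)
  then show ?thesis
    by (simp add: matrix_vector_mult_def vec_eq_iff)
qed

lemma matrix_eq_unitv:
  fixes A B :: "int ^ 'n::finite ^ 'm"
  assumes "\<And>b. A *v unitv b = B *v unitv b"
  shows "A = B"
  using assms by (simp add: matrix_vector_mult_unitv vec_eq_iff)

definition Dmat_inv :: "'n::finite \<Rightarrow> int ^ 'n ^ 'n" where
  "Dmat_inv k = mat 1 - (\<chi> a b. unitv k $ a * (vec 1 - unitv k) $ b)"

lemma Dmat_mult_unitv: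
  "Dmat k *v unitv a = (if a = k then unitv k else unitv a + unitv k)"
  by (simp add: matrix_vector_mult_unitv Dmat_def vec_eq_iff unitv_nth mat_def)

lemma Dmat_inv_mult_unitv:
  "Dmat_inv k *v unitv a = (if a = k then unitv k else unitv a - unitv k)"
  by (simp add: matrix_vector_mult_unitv Dmat_inv_def vec_eq_iff unitv_nth mat_def)

lemma Dmat_Dmat_inv: "Dmat k ** Dmat_inv k = mat 1"
  by (rule matrix_eq_unitv)
     (simp add: matrix_vector_mul_assoc[symmetric] Dmat_inv_mult_unitv
        matrix_vector_mult_diff_distrib Dmat_mult_unitv)

lemma Dmat_inv_Dmat: "Dmat_inv k ** Dmat k = mat 1"
  by (rule matrix_eq_unitv)
     (simp add: matrix_vector_mul_assoc[symmetric] Dmat_mult_unitv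
        matrix_vector_right_distrib Dmat_inv_mult_unitv)

definition DeltaR :: "'n::finite list \<Rightarrow> int ^ 'n ^ 'n" where
  "DeltaR r = (\<chi> a b. deltaR r b $ a)"

lemma DeltaR_mult_unitv: "DeltaR r *v unitv b = deltaR r b"
  by (simp add: matrix_vector_mult_unitv DeltaR_def vec_eq_iff)

lemma DeltaR_Nil: "DeltaR [] = mat 1"
  by (rule matrix_eq_unitv) (simp add: DeltaR_mult_unitv)

lemma DeltaR_Cons: "DeltaR (j # r) = DeltaR r ** Dmat_inv j"
  by (rule matrix_eq_unitv)
     (simp add: matrix_vector_mul_assoc[symmetric] Dmat_inv_mult_unitv
        matrix_vector_mult_diff_distrib DeltaR_mult_unitv)

primrec MR :: "'n::finite list \<Rightarrow> int ^ 'n ^ 'n" where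
  "MR [] = mat 1"
| "MR (j # r) = Dmat j ** MR r"

lemma DeltaR_MR: "DeltaR r ** MR r = mat 1"
proof (induction r)
  case (Cons j r)
  have "DeltaR (j # r) ** MR (j # r) = DeltaR r ** (Dmat_inv j ** Dmat j) ** MR r"
    by (simp add: DeltaR_Cons matrix_mul_assoc)
  with Cons show ?case by (simp add: Dmat_inv_Dmat)
qed (simp add: DeltaR_Nil)

lemma MR_DeltaR: "MR r ** DeltaR r = mat 1"
proof (induction r)
  case (Cons j r)
  have "MR (j # r) ** DeltaR (j # r) = Dmat j ** (MR r ** DeltaR r) ** Dmat_inv j"
    by (simp add: DeltaR_Cons matrix_mul_assoc)
  with Cons show ?case by (simp add: Dmat_Dmat_inv)
qed (simp add: DeltaR_Nil)

definition of_int_mat :: "int ^ 'n::finite ^ 'm::finite \<Rightarrow> real ^ 'n ^ 'm" where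
  "of_int_mat A = (\<chi> a b. real_of_int (A $ a $ b))"

lemma of_int_mat_mult: "of_int_mat (A ** B) = of_int_mat A ** of_int_mat B"
  by (simp add: vec_eq_iff of_int_mat_def matrix_matrix_mult_def)

lemma of_int_mat_1: "of_int_mat (mat 1 :: int ^ 'n::finite ^ 'n) = mat 1"
  by (simp add: vec_eq_iff of_int_mat_def mat_def)

lemma of_int_mat_mult_to_real: "of_int_mat A *v to_real x = to_real (A *v x)"
  by (simp add: vec_eq_iff of_int_mat_def to_real_def matrix_vector_mult_def)

lemma matrix_inv_eqI:
  fixes A B :: "'a::semiring_1 ^ 'n::finite ^ 'n"
  assumes "A ** B = mat 1" "B ** A = mat 1"
  shows "matrix_inv A = B"
proof -
  have inv: "A ** matrix_inv A = mat 1 \<and> matrix_inv A ** A = mat 1"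
    unfolding matrix_inv_def by (rule someI[of _ B]) (use assms in simp)
  have "matrix_inv A = (B ** A) ** matrix_inv A"
    using assms by simp
  also have "\<dots> = B"
    using inv by (simp add: matrix_mul_assoc[symmetric])
  finally show ?thesis .
qed

lemma Mw_eq: "Mw w = of_int_mat (MR (rev w))"
proof -
  have "(\<chi> a b. real_of_int (delta w b $ a)) = of_int_mat (DeltaR (rev w))"
    by (simp add: of_int_mat_def DeltaR_def delta_def)
  then show ?thesis
    by (simp add: Mw_def matrix_inv_eqI of_int_mat_mult[symmetric] DeltaR_MR MR_DeltaR of_int_mat_1)
qed

definition XR :: "'n::finite list \<Rightarrow> (int ^ 'n) set" where
  "XR r = {x. \<forall>i. 0 \<le> (MR r *v x) $ i \<and> (MR r *v x) $ i \<le> uR r $ i}"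

lemma Xw_eq_XR: "Xw w = XR (rev w)"
  unfolding Xw_def XR_def Mw_eq of_int_mat_mult_to_real by (simp add: to_real_def uw_def)

definition ar_subst :: "'n \<Rightarrow> 'n list \<Rightarrow> 'n list" where
  "ar_subst j l = concat (map (\<lambda>i. if i = j then [j] else [i, j]) l)"

lemma ar_subst_Nil [simp]: "ar_subst j [] = []"
  by (simp add: ar_subst_def)

lemma ar_subst_Cons [simp]: "ar_subst j (a # l) = (if a = j then [j] else [a, j]) @ ar_subst j l"
  by (simp add: ar_subst_def)

lemma ar_subst_append [simp]: "ar_subst j (l @ m) = ar_subst j l @ ar_subst j m"
  by (simp add: ar_subst_def)

lemma ar_subst_power: "ar_subst j (concat (replicate m W)) = concat (replicate m (ar_subst j W))"
  by (induction m) auto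

lemma ar_subst_eq_Nil_iff [simp]: "ar_subst j l = [] \<longleftrightarrow> l = []"
  by (cases l) auto

lemma ar_subst_ends_with: "l \<noteq> [] \<Longrightarrow> \<exists>z. ar_subst j l = z @ [j]"
  by (induction l rule: rev_induct) auto

primrec path_word :: "'n::finite list \<Rightarrow> 'n list" where
  "path_word [] = []"
| "path_word (j # r) = j # ar_subst j (path_word r)"

primrec step_word :: "'n::finite list \<Rightarrow> 'n \<Rightarrow> 'n list" where
  "step_word [] k = [k]"
| "step_word (j # r) k = ar_subst j (step_word r k)"

lemma step_word_not_Nil: "step_word r k \<noteq> []"
  by (induction r) auto

lemma path_word_snoc: "path_word (r @ [k]) = path_word r @ step_word r k"
  by (induction r) auto

lemma step_word_snoc:
  "step_word (r @ [k]) i = (if i = k then step_word r k else step_word r i @ step_word r k)"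
  by (induction r) auto

definition parikh :: "'n::finite list \<Rightarrow> int ^ 'n" where
  "parikh l = sum_list (map unitv l)"

lemma parikh_Nil [simp]: "parikh [] = 0"
  by (simp add: parikh_def)

lemma parikh_Cons [simp]: "parikh (a # l) = unitv a + parikh l"
  by (simp add: parikh_def)

lemma parikh_append [simp]: "parikh (l @ m) = parikh l + parikh m"
  by (simp add: parikh_def)

lemma parikh_nonneg: "0 \<le> parikh l $ i"
  by (induction l) (auto simp: unitv_nth)

lemma sum_parikh: "(\<Sum>i\<in>UNIV. parikh l $ i) = int (length l)"
  by (induction l) (auto simp: unitv_nth sum.distrib)

lemma parikh_ar_subst: "parikh (ar_subst j l) = Dmat j *v parikh l"
  by (induction l) (auto simp: Dmat_mult_unitv matrix_vector_right_distrib)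

lemma parikh_path_word: "parikh (path_word r) = uR r"
  by (induction r) (auto simp: parikh_ar_subst)

lemma parikh_step_word: "parikh (step_word r k) = MR r *v unitv k"
  by (induction r) (auto simp: parikh_ar_subst matrix_vector_mul_assoc)

definition prefix_parikhs :: "'n::finite list \<Rightarrow> (int ^ 'n) set" where
  "prefix_parikhs l = (\<lambda>s. parikh (take s l)) ` {..length l}"

lemma prefix_parikhs_Nil [simp]: "prefix_parikhs [] = {0}"
  by (simp add: prefix_parikhs_def)

lemma prefix_parikhs_Cons [simp]:
  "prefix_parikhs (a # l) = insert 0 ((+) (unitv a) ` prefix_parikhs l)"
  by (simp add: prefix_parikhs_def atMost_Suc_eq_insert_0 image_image)

lemma zero_in_prefix_parikhs: "0 \<in> prefix_parikhs l"
  unfolding prefix_parikhs_def by (rule image_eqI[of _ _ 0]) auto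

lemma prefix_parikhs_append:
  "prefix_parikhs (l @ m) = prefix_parikhs l \<union> (+) (parikh l) ` prefix_parikhs m"
  by (induction l) (auto simp: image_image add.assoc zero_in_prefix_parikhs)

lemma parikh_in_prefix_parikhs: "parikh l \<in> prefix_parikhs l"
  unfolding prefix_parikhs_def by (rule image_eqI[of _ _ "length l"]) auto

lemma prefix_parikhs_snoc:
  "prefix_parikhs (l @ [a]) = insert (parikh l + unitv a) (prefix_parikhs l)"
  using parikh_in_prefix_parikhs[of l] by (auto simp: prefix_parikhs_append)

lemma prefix_parikhs_Cons_ar_subst:
  "prefix_parikhs (j # ar_subst j c) =
     (*v) (Dmat j) ` (prefix_parikhs c \<union> (+) (unitv j) ` prefix_parikhs c)"
proof (induction c rule: rev_induct)
  case Nil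
  show ?case by (auto simp: Dmat_mult_unitv)
next
  case (snoc a c)
  define D where "D = Dmat j"
  define R where "R = (*v) D ` (prefix_parikhs c \<union> (+) (unitv j) ` prefix_parikhs c)"
  define q where "q = D *v parikh c + unitv j"
  have IH: "prefix_parikhs (j # ar_subst j c) = R"
    using snoc.IH by (simp add: R_def D_def)
  have "q = D *v (unitv j + parikh c)"
    by (simp add: q_def D_def matrix_vector_right_distrib Dmat_mult_unitv add.commute)
  then have q_in: "q \<in> R"
    unfolding R_def using parikh_in_prefix_parikhs by blast
  have parikh_prefix: "parikh (j # ar_subst j c) = q"
    by (simp add: q_def D_def parikh_ar_subst add.commute)
  have R_snoc: "(*v) D ` (prefix_parikhs (c @ [a]) \<union> (+) (unitv j) ` prefix_parikhs (c @ [a])) =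
      insert (D *v (parikh c + unitv a)) (insert (unitv j + D *v (parikh c + unitv a)) R)"
    by (simp add: R_def prefix_parikhs_snoc D_def matrix_vector_right_distrib Dmat_mult_unitv
        insert_commute)
  show ?case
  proof (cases "a = j")
    case True
    have "prefix_parikhs (j # ar_subst j (c @ [a])) = R \<union> {q, q + unitv j}"
      using IH parikh_prefix True
      by (simp add: prefix_parikhs_append flip: append_Cons)
    moreover have "D *v (parikh c + unitv a) = q"
      using True by (simp add: q_def D_def matrix_vector_right_distrib Dmat_mult_unitv)
    ultimately show ?thesis
      using q_in R_snoc by (auto simp: D_def)
  next
    case False
    have "prefix_parikhs (j # ar_subst j (c @ [a])) = R \<union> {q, q + unitv a, q + unitv a + unitv j}"
      using IH parikh_prefix False
      by (simp add: prefix_parikhs_append add.assoc flip: append_Cons)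
    moreover have "D *v (parikh c + unitv a) = q + unitv a"
      using False by (simp add: q_def D_def Dmat_mult_unitv algebra_simps)
    ultimately show ?thesis
      using q_in R_snoc by (auto simp: D_def)
  qed
qed

lemma BR_eq_prefix_parikhs: "BR r = (*v) (DeltaR r) ` prefix_parikhs (path_word r)"
proof (induction r)
  case Nil
  show ?case by (simp add: DeltaR_Nil)
next
  case (Cons j r)
  define P where "P = prefix_parikhs (path_word r)"
  have "BR (j # r) = BR r \<union> (+) (deltaR r j) ` BR r"
    by (auto simp: add.commute) (metis add.right_neutral)
  also have "\<dots> = (*v) (DeltaR r) ` (P \<union> (+) (unitv j) ` P)"
    by (simp add: Cons P_def image_Un image_image matrix_vector_right_distrib DeltaR_mult_unitv)
  also have "\<dots> = (*v) (DeltaR r ** Dmat_inv j) ` (*v) (Dmat j) ` (P \<union> (+) (unitv j) ` P)"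
    by (simp add: image_image matrix_vector_mul_assoc matrix_mul_assoc[symmetric] Dmat_inv_Dmat)
  also have "\<dots> = (*v) (DeltaR (j # r)) ` prefix_parikhs (path_word (j # r))"
    by (simp only: prefix_parikhs_Cons_ar_subst P_def DeltaR_Cons path_word.simps)
  finally show ?case .
qed

lemma nth_power_shift:
  assumes "i + length W < length (concat (replicate m W))"
  shows "concat (replicate m W) ! i = concat (replicate m W) ! (i + length W)"
proof (cases m)
  case 0
  with assms show ?thesis by simp
next
  case (Suc m')
  let ?l = "concat (replicate m' W)"
  have cons_form: "concat (replicate m W) = W @ ?l"
    using Suc by simp
  have snoc_form: "concat (replicate m W) = ?l @ W"
    unfolding Suc replicate_Suc replicate_append_same[symmetric] by simp
  have "i < length ?l"
    using assms snoc_form by simp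
  then have "concat (replicate m W) ! i = ?l ! i"
    unfolding snoc_form by (simp add: nth_append)
  also have "\<dots> = concat (replicate m W) ! (i + length W)"
    unfolding cons_form by (simp add: nth_append add.commute)
  finally show ?thesis .
qed

lemma parikh_take_power_shift:
  assumes "t + length W \<le> length (concat (replicate m W))"
  shows "parikh (take (t + length W) (concat (replicate m W))) =
    parikh (take t (concat (replicate m W))) + parikh W"
  using assms
proof (induction t)
  case 0
  show ?case
  proof (cases "W = []")
    case False
    with 0 obtain m' where "m = Suc m'" by (cases m) auto
    then show ?thesis by simp
  qed simp
next
  case (Suc t)
  let ?l = "concat (replicate m W)"
  have "?l ! t = ?l ! (t + length W)"
    using Suc.prems by (intro nth_power_shift) simp
  with Suc show ?case
    by (simp add: take_Suc_conv_app_nth algebra_simps)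
qed

lemma parikh_take_suffix_power_shift:
  assumes "z @ c = concat (replicate m W)" "s + length W \<le> length c"
  shows "parikh (take (s + length W) c) = parikh (take s c) + parikh W"
proof -
  have "parikh (take (length z + s + length W) (z @ c)) = parikh (take (length z + s) (z @ c)) + parikh W"
    unfolding assms(1) by (rule parikh_take_power_shift) (use assms in \<open>simp flip: assms(1)\<close>)
  then show ?thesis
    by (simp add: add.assoc)
qed

lemma path_word_suffix_power: "\<exists>z m. z @ path_word r = concat (replicate m (step_word r k))"
proof (induction r)
  case Nil
  have "[] @ path_word [] = concat (replicate 0 (step_word [] k))"
    by simp
  then show ?case by blast
next
  case (Cons j r)
  then obtain z m where suffix_r: "z @ path_word r = concat (replicate m (step_word r k))"
    by blast
  have suffix_subst: "ar_subst j z @ ar_subst j (path_word r) = concat (replicate m (step_word (j # r) k))"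
    using arg_cong[OF suffix_r, of "ar_subst j"] by (simp add: ar_subst_power)
  show ?case
  proof (cases "z = []")
    case False
    then obtain z' where "ar_subst j z = z' @ [j]"
      using ar_subst_ends_with[of z j] by blast
    with suffix_subst have "z' @ path_word (j # r) = concat (replicate m (step_word (j # r) k))"
      by simp
    then show ?thesis by blast
  next
    case True
    obtain z' where "step_word (j # r) k = z' @ [j]"
      using ar_subst_ends_with[OF step_word_not_Nil, of j r k] by auto
    with suffix_subst True have "z' @ path_word (j # r) = concat (replicate (Suc m) (step_word (j # r) k))"
      by simp
    then show ?thesis by blast
  qed
qed

lemma DeltaR_parikh_take_shift:
  assumes "s + length (step_word r k) \<le> length (path_word r)"
  shows "DeltaR r *v parikh (take (s + length (step_word r k)) (path_word r)) =
    DeltaR r *v parikh (take s (path_word r)) + unitv k"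
proof -
  obtain z m where "z @ path_word r = concat (replicate m (step_word r k))"
    using path_word_suffix_power by blast
  from parikh_take_suffix_power_shift[OF this assms] show ?thesis
    by (simp add: matrix_vector_right_distrib parikh_step_word matrix_vector_mul_assoc DeltaR_MR)
qed

definition step_graph :: "nat \<Rightarrow> ('n \<Rightarrow> nat) \<Rightarrow> nat \<Rightarrow> nat \<Rightarrow> bool" where
  "step_graph N len s t \<longleftrightarrow> s \<le> N \<and> t \<le> N \<and> (\<exists>k. t = s + len k \<or> s = t + len k)"

lemma step_graph_connected_extend:
  fixes len :: "'n \<Rightarrow> nat" and k :: 'n
  defines "len' \<equiv> \<lambda>i. if i = k then len k else len i + len k"
  assumes connected: "\<And>s. s \<le> N \<Longrightarrow> (step_graph N len)\<^sup>*\<^sup>* 0 s"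
    and short: "len k \<le> N + 1"
    and s: "s \<le> N + len k"
  shows "(step_graph (N + len k) len')\<^sup>*\<^sup>* 0 s"
proof -
  let ?G = "step_graph (N + len k) len'"
  have lift: "?G\<^sup>*\<^sup>* a b" if "step_graph N len a b" for a b
  proof -
    from that obtain i where ab: "a \<le> N" "b \<le> N" "b = a + len i \<or> a = b + len i"
      unfolding step_graph_def by blast
    show ?thesis
    proof (cases "i = k")
      case True
      with ab have "?G a b"
        by (auto simp: step_graph_def len'_def)
      then show ?thesis by blast
    next
      case False
      have len': "len' i = len i + len k" "len' k = len k"
        using False by (simp_all add: len'_def)
      have edge: "?G x y" if "x \<le> N + len k" "y \<le> N + len k" "y = x + len' l" for x y l
        using that unfolding step_graph_def by blast
      have edge': "?G x y" if "x \<le> N + len k" "y \<le> N + len k" "x = y + len' l" for x y l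
        using that unfolding step_graph_def by blast
      from ab(3) show ?thesis
      proof
        assume "b = a + len i"
        then have "?G a (b + len k)" "?G (b + len k) b"
          using ab len' by (auto intro: edge[of _ _ i] edge'[of _ _ k])
        then show ?thesis
          by (meson rtranclp.rtrancl_into_rtrancl rtranclp.rtrancl_refl)
      next
        assume "a = b + len i"
        then have "?G a (a + len k)" "?G (a + len k) b"
          using ab len' by (auto intro: edge[of _ _ k] edge'[of _ _ i])
        then show ?thesis
          by (meson rtranclp.rtrancl_into_rtrancl rtranclp.rtrancl_refl)
      qed
    qed
  qed
  have old: "?G\<^sup>*\<^sup>* 0 t" if "t \<le> N" for t
    using connected[OF that] lift rtranclp_mono[of "step_graph N len" "?G\<^sup>*\<^sup>*"]
    by auto
  show ?thesis
  proof (cases "s \<le> N")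
    case False
    then have "?G (s - len k) s"
      using short s by (auto simp: step_graph_def len'_def intro!: exI[of _ k])
    moreover have "s - len k \<le> N"
      using s by simp
    ultimately show ?thesis
      by (meson old rtranclp.rtrancl_into_rtrancl)
  qed (rule old)
qed

lemma length_step_word_le: "length (step_word r i) \<le> length (path_word r) + 1"
  by (induction r arbitrary: i rule: rev_induct) (auto simp: path_word_snoc step_word_snoc)

lemma path_word_indices_connected:
  "s \<le> length (path_word r) \<Longrightarrow>
    (step_graph (length (path_word r)) (\<lambda>k. length (step_word r k)))\<^sup>*\<^sup>* 0 s"
proof (induction r arbitrary: s rule: rev_induct)
  case Nil
  then show ?case by simp
next
  case (snoc k r)
  let ?len = "\<lambda>i. length (step_word r i)"
  have len_snoc: "(\<lambda>i. length (step_word (r @ [k]) i)) =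
      (\<lambda>i. if i = k then ?len k else ?len i + ?len k)"
    by (simp add: step_word_snoc fun_eq_iff)
  have "(step_graph (length (path_word r) + ?len k)
      (\<lambda>i. if i = k then ?len k else ?len i + ?len k))\<^sup>*\<^sup>* 0 s"
    using snoc.prems
    by (intro step_graph_connected_extend snoc.IH length_step_word_le) (simp_all add: path_word_snoc)
  then show ?case
    by (simp add: path_word_snoc len_snoc)
qed

lemma to_real_diff: "to_real x - to_real y = to_real (x - y)"
  by (simp add: to_real_def vec_eq_iff)

lemma sum_squares_eq_1_imp_unitv:
  fixes d :: "int ^ 'n::finite"
  assumes sum: "(\<Sum>i\<in>UNIV. (d $ i)\<^sup>2) = 1"
  shows "\<exists>k. d = unitv k \<or> d = - unitv k"
proof -
  obtain k where "d $ k \<noteq> 0"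
    using sum by (metis (mono_tags) power_zero_numeral sum.neutral zero_neq_one)
  have others: "d $ i = 0" if "i \<noteq> k" for i
  proof (rule ccontr)
    assume "d $ i \<noteq> 0"
    with \<open>d $ k \<noteq> 0\<close> have "2 \<le> (d $ k)\<^sup>2 + (d $ i)\<^sup>2"
      by (smt (verit) int_one_le_iff_zero_less zero_less_power2)
    also have "\<dots> = (\<Sum>b\<in>{k, i}. (d $ b)\<^sup>2)"
      using that by simp
    also have "\<dots> \<le> 1"
      unfolding sum[symmetric] by (rule sum_mono2) auto
    finally show False by simp
  qed
  then have "(\<Sum>i\<in>UNIV. (d $ i)\<^sup>2) = (d $ k)\<^sup>2"
    by (subst sum.remove[of _ k]) (auto intro: sum.neutral)
  then have "d $ k = 1 \<or> d $ k = -1"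
    using sum by (simp add: power2_eq_1_iff)
  then show ?thesis
    using others by (auto simp: vec_eq_iff unitv_nth)
qed

lemma adjacent_iff:
  fixes x y :: "int ^ 'n::finite"
  shows "adjacent x y \<longleftrightarrow> (\<exists>k. y = x + unitv k \<or> y = x - unitv k)"
proof -
  have norm_eq: "norm (to_real d) = sqrt (real_of_int (\<Sum>i\<in>UNIV. (d $ i)\<^sup>2))" for d :: "int ^ 'n"
    by (simp add: norm_vec_def L2_set_def to_real_def)
  have "adjacent x y \<longleftrightarrow> (\<Sum>i\<in>UNIV. ((x - y) $ i)\<^sup>2) = 1"
    unfolding adjacent_def dist_norm to_real_diff norm_eq
    by (simp only: real_sqrt_eq_1_iff of_int_eq_1_iff)
  also have "\<dots> \<longleftrightarrow> (\<exists>k. x - y = unitv k \<or> x - y = - unitv k)"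
  proof
    show "(\<Sum>i\<in>UNIV. ((x - y) $ i)\<^sup>2) = 1 \<Longrightarrow> \<exists>k. x - y = unitv k \<or> x - y = - unitv k"
      by (rule sum_squares_eq_1_imp_unitv)
    have "(\<Sum>i\<in>UNIV. (unitv k $ i)\<^sup>2) = (1::int)" for k :: 'n
    proof -
      have "(\<Sum>i\<in>UNIV. (unitv k $ i)\<^sup>2) = (\<Sum>i\<in>UNIV. if i = k then 1 else (0::int))"
        by (rule sum.cong) (auto simp: unitv_nth)
      then show ?thesis by simp
    qed
    then show "\<exists>k. x - y = unitv k \<or> x - y = - unitv k \<Longrightarrow> (\<Sum>i\<in>UNIV. ((x - y) $ i)\<^sup>2) = 1"
      by (elim exE disjE) (simp_all del: vector_minus_component)
  qed
  also have "\<dots> \<longleftrightarrow> (\<exists>k. y = x - unitv k \<or> y = x + unitv k)"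
    by (simp add: eq_diff_eq diff_eq_eq minus_equation_iff[of "x - y"] add.commute eq_commute)
  finally show ?thesis
    by blast
qed

lemma Comp0_eqI:
  assumes "S \<subseteq> X" "0 \<in> S"
    and closed: "\<And>y z. y \<in> S \<Longrightarrow> z \<in> X \<Longrightarrow> adjacent y z \<Longrightarrow> z \<in> S"
    and connected: "\<And>y. y \<in> S \<Longrightarrow> (\<lambda>a b. a \<in> S \<and> b \<in> S \<and> adjacent a b)\<^sup>*\<^sup>* 0 y"
  shows "Comp0 X = S"
proof -
  let ?E = "\<lambda>a b. a \<in> X \<and> b \<in> X \<and> adjacent a b"
  have "y \<in> S" if "?E\<^sup>*\<^sup>* 0 y" for y
    using that by (induction rule: rtranclp_induct) (use assms in auto)
  moreover have "?E\<^sup>*\<^sup>* 0 y" if "y \<in> S" for y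
    using connected[OF that] rtranclp_mono[of "\<lambda>a b. a \<in> S \<and> b \<in> S \<and> adjacent a b" ?E]
      assms(1) by auto
  ultimately show ?thesis
    using assms(1,2) unfolding Comp0_def by auto
qed

lemma MR_mult_DeltaR [simp]: "MR r *v (DeltaR r *v y) = y"
  by (simp add: matrix_vector_mul_assoc MR_DeltaR)

lemma prefix_point_in_XR: "DeltaR r *v parikh (take s (path_word r)) \<in> XR r"
proof -
  have "uR r = parikh (take s (path_word r)) + parikh (drop s (path_word r))"
    by (simp flip: parikh_path_word parikh_append)
  then show ?thesis
    using parikh_nonneg[of "drop s (path_word r)"]
    by (auto simp: XR_def parikh_nonneg)
qed

lemma XR_coord_sum_bounds:
  assumes "z \<in> XR r"
  shows "0 \<le> (\<Sum>i\<in>UNIV. (MR r *v z) $ i) \<and> (\<Sum>i\<in>UNIV. (MR r *v z) $ i) \<le> int (length (path_word r))"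
proof -
  have "(\<Sum>i\<in>UNIV. (MR r *v z) $ i) \<le> (\<Sum>i\<in>UNIV. uR r $ i)"
    using assms by (intro sum_mono) (simp add: XR_def)
  moreover have "0 \<le> (\<Sum>i\<in>UNIV. (MR r *v z) $ i)"
    using assms by (intro sum_nonneg) (simp add: XR_def)
  ultimately show ?thesis
    by (simp flip: parikh_path_word add: sum_parikh)
qed

lemma BR_eq_Comp0_XR: "BR r = Comp0 (XR r)"
proof -
  define c where "c = path_word r"
  define x where "x s = DeltaR r *v parikh (take s c)" for s
  let ?len = "\<lambda>k. length (step_word r k)"
  have BR: "BR r = x ` {..length c}"
    by (simp add: BR_eq_prefix_parikhs prefix_parikhs_def x_def c_def image_image)
  have x_shift: "x (s + ?len k) = x s + unitv k" if "s + ?len k \<le> length c" for s k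
    using DeltaR_parikh_take_shift that by (simp add: x_def c_def)
  have coord_sum_plus: "(\<Sum>i\<in>UNIV. (MR r *v (x s + unitv k)) $ i) = int (min s (length c)) + int (?len k)"
    for s k
    by (simp add: x_def matrix_vector_right_distrib sum.distrib sum_parikh flip: parikh_step_word)
  have coord_sum_minus: "(\<Sum>i\<in>UNIV. (MR r *v (x s - unitv k)) $ i) = int (min s (length c)) - int (?len k)"
    for s k
    by (simp add: x_def matrix_vector_mult_diff_distrib sum_subtractf sum_parikh flip: parikh_step_word)
  show ?thesis
  proof (rule Comp0_eqI[symmetric])
    show "BR r \<subseteq> XR r"
      using prefix_point_in_XR by (auto simp: BR x_def c_def)
    show "0 \<in> BR r"
      using BR by (force simp: x_def)
  next
    fix y z
    assume "y \<in> BR r" "z \<in> XR r" "adjacent y z"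
    then obtain s k where s: "s \<le> length c" "y = x s" and "z = y + unitv k \<or> z = y - unitv k"
      by (auto simp: BR adjacent_iff)
    then show "z \<in> BR r"
    proof (elim disjE)
      assume z: "z = y + unitv k"
      then have "s + ?len k \<le> length c"
        using XR_coord_sum_bounds[OF \<open>z \<in> XR r\<close>] coord_sum_plus[of s k] s by (simp add: c_def)
      then have "z = x (s + ?len k)"
        using z s x_shift by simp
      with \<open>s + ?len k \<le> length c\<close> show ?thesis
        by (auto simp: BR)
    next
      assume z: "z = y - unitv k"
      then have "?len k \<le> s"
        using XR_coord_sum_bounds[OF \<open>z \<in> XR r\<close>] coord_sum_minus[of s k] s by simp
      with z s x_shift[of "s - ?len k" k] show ?thesis
        by (auto simp: BR)
    qed
  next
    fix y
    assume "y \<in> BR r"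
    then obtain s where "s \<le> length c" "y = x s"
      by (auto simp: BR)
    have "(step_graph (length c) ?len)\<^sup>*\<^sup>* 0 s"
      using path_word_indices_connected \<open>s \<le> length c\<close> by (simp add: c_def)
    then have "(\<lambda>a b. a \<in> BR r \<and> b \<in> BR r \<and> adjacent a b)\<^sup>*\<^sup>* (x 0) (x s)"
    proof (induction rule: rtranclp_induct)
      case (step a b)
      then obtain k where "a \<le> length c" "b \<le> length c" "b = a + ?len k \<or> a = b + ?len k"
        by (auto simp: step_graph_def)
      then have "x a \<in> BR r" "x b \<in> BR r" "adjacent (x a) (x b)"
        using x_shift by (auto simp: BR adjacent_iff)
      with step.IH show ?case
        by (simp add: rtranclp.rtrancl_into_rtrancl)
    qed simp
    then show "(\<lambda>a b. a \<in> BR r \<and> b \<in> BR r \<and> adjacent a b)\<^sup>*\<^sup>* 0 y"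
      by (simp add: x_def \<open>y = x s\<close>)
  qed
qed

theorem corollary3p6:
  fixes w :: "'n::finite list"
  shows "Bw w = Comp0 (Xw w)"
  unfolding Bw_def Xw_eq_XR by (rule BR_eq_Comp0_XR)

end
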